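(* Let $G$ be a finite group and $A \le \mathrm{Inn}(G)$. Then $\Delta(G,A)$ is a complete graph if and only if $G$ is a cyclic group.
   Context: For a finite group $G$ and a subgroup $A \le \mathrm{Aut}(G)$, write $g^A = \{g^a \mid a \in A\}$ for the $A$-orbit of $g \in G$. The automorphic cyclic graph $\Delta(G,A)$ is the simple graph with vertex set $\{g^A : 1 \ne g \in G\}$, in which two distinct vertices $x^A, y^A$ are joined by an edge if there exist $x' \in x^A$ and $y' \in y^A$ such that $\langle x', y' \rangle$ is cyclic. $\mathrm{Inn}(G)$ is the group of inner automorphisms of $G$. *)

theory Defs
  imports
    "HOL-Algebra.Bij"
    "HOL-Algebra.Elementary_Groups"
    "Graph_Theory.Kuratowski"
begin

text \<open>Conjugation is restricted to the carrier because the elements of \<^term>\<open>AutoGroup G\<close>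
  are extensional functions.\<close>

definition inner_auto :: "('a, 'b) monoid_scheme \<Rightarrow> 'a \<Rightarrow> ('a \<Rightarrow> 'a)" where
  "inner_auto G g = (\<lambda>x \<in> carrier G. inv\<^bsub>G\<^esub> g \<otimes>\<^bsub>G\<^esub> x \<otimes>\<^bsub>G\<^esub> g)"

definition InnGroup :: "('a, 'b) monoid_scheme \<Rightarrow> ('a \<Rightarrow> 'a) monoid" where
  "InnGroup G = (AutoGroup G) \<lparr>carrier := inner_auto G ` carrier G\<rparr>"

definition aut_orbit :: "('a \<Rightarrow> 'a) set \<Rightarrow> 'a \<Rightarrow> 'a set" where
  "aut_orbit A x = {a x | a. a \<in> A}"

text \<open>As usual in the library, a simple graph is a loop-free symmetric digraph: an undirected edge
  between \<open>X\<close> and \<open>Y\<close> is the pair of arcs \<open>(X, Y)\<close>, \<open>(Y, X)\<close>.\<close>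

definition automorphic_cyclic_graph ::
    "('a, 'b) monoid_scheme \<Rightarrow> ('a \<Rightarrow> 'a) set \<Rightarrow> 'a set pair_pre_digraph" where
  "automorphic_cyclic_graph G A =
    (let V = {aut_orbit A g | g. g \<in> carrier G \<and> g \<noteq> \<one>\<^bsub>G\<^esub>} in
     \<lparr>pverts = V,
      parcs = {(X, Y). X \<in> V \<and> Y \<in> V \<and> X \<noteq> Y \<and>
        (\<exists>x' \<in> X. \<exists>y' \<in> Y. cyclic_group (subgroup_generated G {x', y'}))}\<rparr>)"

lemma (in group) inner_auto_in_auto:
  assumes "g \<in> carrier G"
  shows "inner_auto G g \<in> auto G"
proof -
  have conj_cancel: "g \<otimes> (inv g \<otimes> x) = x" "inv g \<otimes> (g \<otimes> x) = x" if "x \<in> carrier G" for x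
    using assms that by (simp_all flip: m_assoc)
  have "bij_betw (inner_auto G g) (carrier G) (carrier G)"
    by (rule bij_betw_byWitness[where f' = "\<lambda>x. g \<otimes> x \<otimes> inv g"])
      (use assms in \<open>auto simp: inner_auto_def m_assoc conj_cancel\<close>)
  moreover have "inner_auto G g \<in> hom G G"
  proof (rule homI)
    fix x y assume xy: "x \<in> carrier G" "y \<in> carrier G"
    have "inv g \<otimes> (x \<otimes> y) \<otimes> g = inv g \<otimes> x \<otimes> (g \<otimes> inv g) \<otimes> y \<otimes> g"
      using assms xy by (simp add: m_assoc)
    also have "\<dots> = (inv g \<otimes> x \<otimes> g) \<otimes> (inv g \<otimes> y \<otimes> g)"
      using assms xy by (simp add: m_assoc conj_cancel)
    finally show "inner_auto G g (x \<otimes> y) = inner_auto G g x \<otimes> inner_auto G g y"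
      using xy by (simp add: inner_auto_def)
  qed (use assms in \<open>auto simp: inner_auto_def\<close>)
  ultimately show ?thesis
    by (simp add: auto_def Bij_def inner_auto_def)
qed

lemma (in group) inner_auto_mult:
  assumes "g \<in> carrier G" "h \<in> carrier G"
  shows "inner_auto G g \<otimes>\<^bsub>AutoGroup G\<^esub> inner_auto G h = inner_auto G (h \<otimes> g)"
proof -
  have "inner_auto G g \<in> Bij (carrier G)" "inner_auto G h \<in> Bij (carrier G)"
    using inner_auto_in_auto assms by (auto simp: auto_def)
  then have "inner_auto G g \<otimes>\<^bsub>AutoGroup G\<^esub> inner_auto G h =
      compose (carrier G) (inner_auto G g) (inner_auto G h)"
    by (simp add: AutoGroup_def BijGroup_def)
  also have "\<dots> = inner_auto G (h \<otimes> g)"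
    using assms by (auto simp: inner_auto_def compose_def restrict_def fun_eq_iff
      m_assoc inv_mult_group)
  finally show ?thesis .
qed

lemma (in group) inner_auto_one: "inner_auto G \<one> = \<one>\<^bsub>AutoGroup G\<^esub>"
  by (auto simp: inner_auto_def AutoGroup_def BijGroup_def restrict_def fun_eq_iff)

lemma (in group) subgroup_inner_auto: "subgroup (inner_auto G ` carrier G) (AutoGroup G)"
proof (rule group.subgroupI[OF AutoGroup])
  show "inner_auto G ` carrier G \<subseteq> carrier (AutoGroup G)"
    using inner_auto_in_auto by (auto simp: AutoGroup_def)
  fix f assume "f \<in> inner_auto G ` carrier G"
  then obtain g where g: "g \<in> carrier G" "f = inner_auto G g" by auto
  have "inv\<^bsub>AutoGroup G\<^esub> f = inner_auto G (inv g)"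
    by (rule group.inv_equality[OF AutoGroup])
      (use g inner_auto_in_auto in \<open>simp_all add: inner_auto_mult inner_auto_one, simp_all add: AutoGroup_def\<close>)
  then show "inv\<^bsub>AutoGroup G\<^esub> f \<in> inner_auto G ` carrier G" using g by simp
qed (auto simp: inner_auto_mult)

lemma (in group) group_InnGroup: "group (InnGroup G)"
  unfolding InnGroup_def
  by (rule subgroup.subgroup_is_group[OF subgroup_inner_auto AutoGroup])

lemma graph_automorphic_cyclic_graph:
  assumes "finite (carrier G)"
  shows "graph (with_proj (automorphic_cyclic_graph G A))"
proof -
  let ?D = "automorphic_cyclic_graph G A"
  have V: "finite (pverts ?D)"
    using assms by (simp add: automorphic_cyclic_graph_def Let_def)
  have E: "parcs ?D \<subseteq> pverts ?D \<times> pverts ?D"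
    by (auto simp: automorphic_cyclic_graph_def Let_def)
  have "finite (parcs ?D)"
    using V E by (meson finite_SigmaI finite_subset)
  moreover have "sym (parcs ?D)"
    unfolding automorphic_cyclic_graph_def Let_def sym_def
    by (simp, metis insert_commute)
  moreover have "fst e \<noteq> snd e" if "e \<in> parcs ?D" for e
    using that by (auto simp: automorphic_cyclic_graph_def Let_def)
  ultimately show ?thesis
    using V E by unfold_locales
      (auto simp: symmetric_def arc_to_ends_def)
qed

end

theory Submission
  imports Defs "HOL-Algebra.Multiplicative_Group"
begin

text \<open>Completeness of the graph means that any two elements of \<open>G\<close> have conjugates lying in a common
  cyclic subgroup. Apply this to an element \<open>c\<close> of maximal order and an arbitrary \<open>y\<close>: a cyclic
  subgroup containing a conjugate of \<open>c\<close> is generated by it, so \<open>y\<close> has a conjugate in \<open>\<langle>c\<rangle>\<close>.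
  Hence \<open>G\<close> is the union of the conjugates of \<open>\<langle>c\<rangle>\<close>, which for a finite group forces
  \<open>\<langle>c\<rangle> = G\<close>.\<close>

text \<open>The exponents \<open>n\<close> with \<open>x [^] n \<in> H\<close> form a subgroup of
  the integers; its generator \<open>d\<close> yields the generator \<open>x [^] d\<close> of
  \<open>H\<close>.\<close>

lemma (in group) cyclic_group_subgroup_generated:
  assumes "cyclic_group G"
  shows "cyclic_group (subgroup_generated G S)"
proof -
  let ?K = "subgroup_generated G S"
  define H where "H = carrier ?K"
  have sub: "subgroup H G"
    unfolding H_def by (rule subgroup_subgroup_generated)
  obtain x where x: "x \<in> carrier G" "carrier G = range (\<lambda>n::int. x [^] n)"
    using assms cyclic_group by auto
  have "\<exists>d::int. x [^] d \<in> H \<and> (\<forall>n::int. x [^] n \<in> H \<longrightarrow> d dvd n)"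
  proof (cases "\<exists>n>0. x [^] int n \<in> H")
    case True
    define d where "d = (LEAST n. n > 0 \<and> x [^] int n \<in> H)"
    have d: "d > 0" "x [^] int d \<in> H"
      using LeastI_ex[OF True] by (auto simp: d_def)
    have "int d dvd n" if n: "x [^] n \<in> H" for n :: int
    proof (rule ccontr)
      assume "\<not> int d dvd n"
      then have pos: "n mod int d > 0"
        using d pos_mod_sign[of "int d" n] mod_0_imp_dvd[of n "int d"] by linarith
      \<comment> \<open>Dividing with remainder: the power of \<open>x\<close> to the remainder lies
        in \<open>H\<close> as well, against the minimality of \<open>d\<close>.\<close>
      have "x [^] (n mod int d) = x [^] (n - int d * (n div int d))"
        by (simp only: minus_mult_div_eq_mod)
      also have "\<dots> = x [^] n \<otimes> inv ((x [^] int d) [^] (n div int d))"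
        using x by (simp only: int_pow_diff int_pow_pow)
      also have "\<dots> \<in> H"
        using n d sub by (simp add: subgroup.m_closed subgroup.m_inv_closed subgroup_int_pow_closed)
      finally have "d \<le> nat (n mod int d)"
        using pos unfolding d_def by (intro Least_le) auto
      then show False
        using pos d pos_mod_bound[of "int d" n] by linarith
    qed
    with d show ?thesis by blast
  next
    case False
    \<comment> \<open>Only the zero exponent leads into \<open>H\<close> here, so the witness is
      \<open>d = 0\<close>, which divides nothing but 0.\<close>
    have "n = 0" if n: "x [^] n \<in> H" for n :: int
    proof (rule ccontr)
      assume "n \<noteq> 0"
      have "x [^] \<bar>n\<bar> \<in> H"
        using n x subgroup.m_inv_closed[OF sub n] by (cases "n \<ge> 0") (auto simp: int_pow_neg)
      with \<open>n \<noteq> 0\<close> False show False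
        by (metis zero_less_abs_iff zero_less_nat_eq nat_0_le abs_ge_zero)
    qed
    then have "\<forall>n::int. x [^] n \<in> H \<longrightarrow> 0 dvd n"
      by simp
    moreover have "x [^] (0::int) \<in> H"
      using sub by (simp add: subgroup.one_closed)
    ultimately show ?thesis by blast
  qed
  then obtain d :: int where d: "x [^] d \<in> H" "\<And>n::int. x [^] n \<in> H \<Longrightarrow> d dvd n"
    by blast
  have "H = range (\<lambda>k::int. (x [^] d) [^] k)"
  proof
    show "range (\<lambda>k::int. (x [^] d) [^] k) \<subseteq> H"
      using d sub by (auto simp: subgroup_int_pow_closed)
    show "H \<subseteq> range (\<lambda>k::int. (x [^] d) [^] k)"
    proof
      fix h assume "h \<in> H"
      moreover from this obtain n :: int where n: "h = x [^] n"
        using x subgroup.subset[OF sub] by auto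
      ultimately obtain k where "n = d * k"
        using d by (auto elim: dvdE)
      then show "h \<in> range (\<lambda>k::int. (x [^] d) [^] k)"
        using n x by (simp add: int_pow_pow)
    qed
  qed
  moreover have "(x [^] d) [^]\<^bsub>?K\<^esub> k = (x [^] d) [^] k" for k :: int
    using d by (intro int_pow_subgroup_generated) (simp add: H_def)
  ultimately show ?thesis
    using d unfolding group.cyclic_group[OF group_subgroup_generated] H_def
    by (intro bexI[of _ "x [^] d"]) simp_all
qed

lemma (in group) inner_auto_closed:
  "g \<in> carrier G \<Longrightarrow> x \<in> carrier G \<Longrightarrow> inner_auto G g x \<in> carrier G"
  by (simp add: inner_auto_def)

lemma (in group) inner_auto_inner_auto:
  assumes "g \<in> carrier G" "h \<in> carrier G" "x \<in> carrier G"
  shows "inner_auto G h (inner_auto G g x) = inner_auto G (g \<otimes> h) x"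
  using assms by (simp add: inner_auto_def m_assoc inv_mult_group)

lemma (in group) inner_auto_eq_one_iff:
  assumes "g \<in> carrier G" "x \<in> carrier G"
  shows "inner_auto G g x = \<one> \<longleftrightarrow> x = \<one>"
proof
  assume "inner_auto G g x = \<one>"
  then have "inner_auto G (inv g) (inner_auto G g x) = inner_auto G (inv g) \<one>"
    by simp
  then show "x = \<one>"
    using assms by (simp add: inner_auto_inner_auto) (simp add: inner_auto_def)
qed (use assms in \<open>simp add: inner_auto_def\<close>)

lemma (in group) inj_on_inner_auto:
  "g \<in> carrier G \<Longrightarrow> inj_on (inner_auto G g) (carrier G)"
  using inner_auto_in_auto by (auto simp: auto_def Bij_def bij_betw_def)

lemma (in group) inner_auto_group_hom:
  "g \<in> carrier G \<Longrightarrow> group_hom G G (inner_auto G g)"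
  using inner_auto_in_auto by unfold_locales (auto simp: auto_def)

lemma (in group) inner_auto_int_pow:
  fixes n :: int
  assumes "g \<in> carrier G" "x \<in> carrier G"
  shows "inner_auto G g x [^] n = inner_auto G g (x [^] n)"
  using group_hom.hom_int_pow[OF inner_auto_group_hom] assms by metis

lemma (in group) ord_inner_auto:
  assumes "g \<in> carrier G" "x \<in> carrier G"
  shows "ord (inner_auto G g x) = ord x"
proof -
  have "inner_auto G g x [^] n = inner_auto G g (x [^] n)" for n :: nat
    using inner_auto_int_pow[OF assms, of "int n"] by (simp add: int_pow_int)
  then show ?thesis
    using assms by (simp add: ord_unique inner_auto_closed inner_auto_eq_one_iff pow_eq_id)
qed

text \<open>Count the pairs \<open>(g, x)\<close> with \<open>x \<noteq> \<one>\<close> and \<open>x\<^sup>g \<in> H\<close>. Each \<open>x\<close> admits a full coset of \<open>H\<close> of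
  such \<open>g\<close>, and each \<open>g\<close> admits at most \<open>|H| - 1\<close> such \<open>x\<close>, so
  \<open>(|G| - 1) |H| \<le> |G| (|H| - 1)\<close>.\<close>

lemma (in group) subgroup_eq_carrier_if_conjugates_cover:
  assumes fin: "finite (carrier G)" and H: "subgroup H G"
    and cover: "\<And>x. x \<in> carrier G \<Longrightarrow> x \<noteq> \<one> \<Longrightarrow> \<exists>g\<in>carrier G. inner_auto G g x \<in> H"
  shows "H = carrier G"
proof -
  let ?X = "carrier G - {\<one>}"
  have HG: "H \<subseteq> carrier G" and finH: "finite H"
    using subgroup.subset[OF H] fin by (auto intro: finite_subset)
  have coset: "card H \<le> card {g \<in> carrier G. inner_auto G g x \<in> H}" if x: "x \<in> ?X" for x
  proof -
    obtain g where g: "g \<in> carrier G" "inner_auto G g x \<in> H"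
      using cover x by auto
    \<comment> \<open>Conjugation by an element of \<open>H\<close> preserves \<open>H\<close>, so
      the whole coset of \<open>g\<close> conjugates \<open>x\<close> into \<open>H\<close>.\<close>
    have "inner_auto G (g \<otimes> h) x \<in> H" if "h \<in> H" for h
    proof -
      have "inner_auto G (g \<otimes> h) x = inv h \<otimes> inner_auto G g x \<otimes> h"
        using g x that HG by (auto simp: subset_iff inner_auto_def m_assoc inv_mult_group)
      then show ?thesis
        using g that H by (simp add: subgroup.m_closed subgroup.m_inv_closed)
    qed
    then have "(\<lambda>h. g \<otimes> h) ` H \<subseteq> {g \<in> carrier G. inner_auto G g x \<in> H}"
      using g HG by auto
    moreover have "inj_on (\<lambda>h. g \<otimes> h) H"
      using g HG by (intro inj_onI) (auto simp: subset_iff)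
    ultimately show ?thesis
      using fin by (intro card_inj_on_le) auto
  qed
  \<comment> \<open>Conjugation by \<open>g\<close> is injective and sends only the identity to the
    identity, so it embeds these \<open>x\<close> into \<open>H - {\<one>}\<close>.\<close>
  have conj: "card {x \<in> ?X. inner_auto G g x \<in> H} \<le> card H - 1" if g: "g \<in> carrier G" for g
  proof -
    have "card {x \<in> ?X. inner_auto G g x \<in> H} \<le> card (H - {\<one>})"
      using g finH inner_auto_eq_one_iff
      by (intro card_inj_on_le[OF inj_on_subset[OF inj_on_inner_auto[OF g]]]) auto
    then show ?thesis
      using H finH by (simp add: subgroup.one_closed)
  qed
  have "card ?X * card H \<le> (\<Sum>x\<in>?X. card {g \<in> carrier G. inner_auto G g x \<in> H})"
    using sum_mono[of ?X "\<lambda>_. card H"] coset by simp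
  also have "\<dots> = (\<Sum>g\<in>carrier G. card {x \<in> ?X. inner_auto G g x \<in> H})"
    using fin by (intro sum_multicount_gen) auto
  also have "\<dots> \<le> card (carrier G) * (card H - 1)"
    using sum_mono[of "carrier G" _ "\<lambda>_. card H - 1"] conj by simp
  finally have le: "(card (carrier G) - 1) * card H \<le> card (carrier G) * (card H - 1)"
    using fin by simp
  \<comment> \<open>Both subtractions in \<open>le\<close> are on natural numbers; as neither is
    truncated, \<open>le\<close> rearranges to |G| \<le> |H|.\<close>
  have "card H \<ge> 1"
    using finH subgroup.one_closed[OF H] by (auto simp: Suc_le_eq card_gt_0_iff)
  moreover have "card (carrier G) \<ge> card H"
    using fin HG by (simp add: card_mono)
  ultimately have "card (carrier G) \<le> card H"
    using le by (cases "card H"; cases "card (carrier G)") auto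
  then show ?thesis
    using fin HG by (simp add: card_seteq)
qed

text \<open>This separates the group theory from the graph. The conjugators range over all of
  \<open>G\<close> because an orbit under \<open>A\<close> lies inside a conjugacy class.\<close>

lemma (in group) cyclic_if_conjugates_in_cyclic:
  assumes fin: "finite (carrier G)"
    and conj: "\<And>x y. \<lbrakk>x \<in> carrier G; x \<noteq> \<one>; y \<in> carrier G; y \<noteq> \<one>\<rbrakk> \<Longrightarrow>
      \<exists>a\<in>carrier G. \<exists>b\<in>carrier G.
        cyclic_group (subgroup_generated G {inner_auto G a x, inner_auto G b y})"
  shows "cyclic_group G"
proof -
  obtain c where c: "c \<in> carrier G" and c_max: "\<And>y. y \<in> carrier G \<Longrightarrow> ord y \<le> ord c"
    using obtains_MAX[OF fin, of ord] fin by (metis empty_iff one_closed Max_ge finite_imageI imageI)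
  have "carrier (subgroup_generated G {c}) = carrier G"
  proof (rule subgroup_eq_carrier_if_conjugates_cover[OF fin subgroup_subgroup_generated])
    fix y assume y: "y \<in> carrier G" "y \<noteq> \<one>"
    \<comment> \<open>\<open>conj\<close> speaks of nontrivial elements only. If \<open>c\<close>
      were trivial, the maximal order would be 1, contradicting
      \<open>y \<noteq> \<one>\<close>.\<close>
    have "c \<noteq> \<one>"
      using c_max[OF y(1)] y ord_eq_1[OF y(1)] ord_ge_1[OF fin y(1)] by auto
    then obtain a b where ab: "a \<in> carrier G" "b \<in> carrier G"
      and cyc: "cyclic_group (subgroup_generated G {inner_auto G a c, inner_auto G b y})"
      using conj c y by blast
    define c' y' where "c' = inner_auto G a c" and "y' = inner_auto G b y"
    have c': "c' \<in> carrier G" and y': "y' \<in> carrier G"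
      using ab c y by (simp_all add: c'_def y'_def inner_auto_closed)
    let ?K = "subgroup_generated G {c', y'}"
    obtain z where z: "z \<in> carrier ?K" and K: "carrier ?K = range (\<lambda>n::int. z [^] n)"
      using cyc int_pow_subgroup_generated[of _ "{c', y'}"]
      by (auto simp: group.cyclic_group[OF group_subgroup_generated] c'_def y'_def)
    have zG: "z \<in> carrier G"
      using z carrier_subgroup_generated_subset by blast
    have K_gen: "carrier ?K = generate G {z}"
      using K zG by (auto simp: generate_pow)
    have in_K: "c' \<in> carrier ?K" "y' \<in> carrier ?K"
      using subgroup_generated_subset_carrier_subset[of "{c', y'}"] c' y' by auto
    \<comment> \<open>The order of \<open>?K\<close> is that of its generator \<open>z\<close>,
      hence at most the order of \<open>c\<close>, which its conjugate \<open>c'\<close>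
      shares.\<close>
    have "generate G {c'} = carrier ?K"
    proof (rule card_seteq)
      show "finite (carrier ?K)"
        using fin carrier_subgroup_generated_subset by (rule finite_subset[rotated])
      show "generate G {c'} \<subseteq> carrier ?K"
        using in_K by (intro generate_subgroup_incl subgroup_subgroup_generated) auto
      show "card (carrier ?K) \<le> card (generate G {c'})"
        unfolding K_gen using c_max[OF zG] ord_inner_auto[OF ab(1) c] c' zG
        by (simp add: c'_def flip: generate_pow_card)
    qed
    with in_K obtain n :: int where "y' = c' [^] n"
      using c' by (auto simp: generate_pow)
    then have "inner_auto G b y = inner_auto G a (c [^] n)"
      using ab c by (simp add: c'_def y'_def inner_auto_int_pow)
    \<comment> \<open>Undoing the conjugation by \<open>a\<close> shows that
      \<open>b \<otimes> inv a\<close> conjugates \<open>y\<close> to a power of \<open>c\<close>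
      itself.\<close>
    then have "inner_auto G (inv a) (inner_auto G b y) = inner_auto G (inv a) (inner_auto G a (c [^] n))"
      by simp
    then have "inner_auto G (b \<otimes> inv a) y = c [^] n"
      using ab c y by (simp add: inner_auto_inner_auto) (simp add: inner_auto_def)
    then have "inner_auto G (b \<otimes> inv a) y \<in> carrier (subgroup_generated G {c})"
      using c by (simp add: carrier_subgroup_generated_by_singleton)
    then show "\<exists>g\<in>carrier G. inner_auto G g y \<in> carrier (subgroup_generated G {c})"
      using ab by blast
  qed
  then show ?thesis
    using c cyclic_group carrier_subgroup_generated_by_singleton by metis
qed

theorem theorem5:
  fixes G :: "('a, 'b) monoid_scheme" and A :: "('a \<Rightarrow> 'a) set"
  assumes "group G" and "finite (carrier G)" and "subgroup A (InnGroup G)"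
  shows "(\<exists>n. complete_digraph n (with_proj (automorphic_cyclic_graph G A))) \<longleftrightarrow> cyclic_group G"
proof -
  interpret group G by fact
  let ?D = "automorphic_cyclic_graph G A"
  have A: "A \<subseteq> inner_auto G ` carrier G"
    using subgroup.subset[OF assms(3)] by (simp add: InnGroup_def)
  \<comment> \<open>The neutral element of \<open>A\<close> is conjugation by the identity, so every
    element represents its own orbit.\<close>
  have "inner_auto G \<one>\<^bsub>G\<^esub> \<in> A"
    using subgroup.one_closed[OF assms(3)] by (simp add: InnGroup_def inner_auto_one)
  then have self: "x \<in> aut_orbit A x" if "x \<in> carrier G" for x
    unfolding aut_orbit_def using that
    by (intro CollectI exI[of _ "inner_auto G \<one>\<^bsub>G\<^esub>"]) (simp add: inner_auto_def)
  \<comment> \<open>The parameter of \<open>complete_digraph\<close> is the number of vertices.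
    Since the vertex set is finite, quantifying over it leaves just the condition on arcs.\<close>
  have complete: "(\<exists>n. complete_digraph n (with_proj ?D)) \<longleftrightarrow>
      parcs ?D = {(u, v). (u, v) \<in> pverts ?D \<times> pverts ?D \<and> u \<noteq> v}"
    using assms(2) by (auto simp: complete_digraph_pair_def automorphic_cyclic_graph_def Let_def)
  show ?thesis
    unfolding complete
  proof
    assume arcs: "parcs ?D = {(u, v). (u, v) \<in> pverts ?D \<times> pverts ?D \<and> u \<noteq> v}"
    show "cyclic_group G"
    proof (rule cyclic_if_conjugates_in_cyclic[OF assms(2)])
      fix x y assume xy: "x \<in> carrier G" "x \<noteq> \<one>\<^bsub>G\<^esub>" "y \<in> carrier G" "y \<noteq> \<one>\<^bsub>G\<^esub>"
      let ?X = "aut_orbit A x" and ?Y = "aut_orbit A y"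
      have "\<exists>x'\<in>?X. \<exists>y'\<in>?Y. cyclic_group (subgroup_generated G {x', y'})"
      \<comment> \<open>A loop-free graph says nothing about equal orbits, but then \<open>x\<close>
        can represent both.\<close>
      proof (cases "?X = ?Y")
        case True
        then have "x \<in> ?X" "x \<in> ?Y" "cyclic_group (subgroup_generated G {x, x})"
          using self xy cyclic_group_generated by auto
        then show ?thesis by blast
      next
        case False
        then have "(?X, ?Y) \<in> parcs ?D"
          unfolding arcs using xy by (auto simp: automorphic_cyclic_graph_def Let_def)
        then show ?thesis
          by (simp add: automorphic_cyclic_graph_def Let_def)
      qed
      then show "\<exists>a\<in>carrier G. \<exists>b\<in>carrier G.
          cyclic_group (subgroup_generated G {inner_auto G a x, inner_auto G b y})"
        using A unfolding aut_orbit_def by blast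
    qed
  next
    assume "cyclic_group G"
    \<comment> \<open>Every pair of representatives now generates a cyclic subgroup;
      \<open>self\<close> supplies one pair for any two vertices.\<close>
    then have "cyclic_group (subgroup_generated G S)" for S
      by (rule cyclic_group_subgroup_generated)
    then show "parcs ?D = {(u, v). (u, v) \<in> pverts ?D \<times> pverts ?D \<and> u \<noteq> v}"
      using self by (fastforce simp: automorphic_cyclic_graph_def Let_def)
  qed
qed

end
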